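(* Let $f:\mathbb{R}\to\mathbb{R}$ be a smooth convex function with a unique extreme point (minimizer) $t^*$, satisfying Lipschitz continuous gradient: there is $\mu>0$ with $|f^{(1)}(x)-f^{(1)}(y)|\le \mu|x-y|$ for all $x,y\in\mathbb{R}$. Let $\rho>0$ be arbitrary, let $0<\alpha_1<1<\alpha_2<2$, and let $\delta_2\ge(\rho\mu)^{\frac{1}{\alpha_2-1}}$. Then the switching fractional order gradient method with parameters $\rho,\alpha_1,\alpha_2,\delta_2$ (defined in the context) guarantees global asymptotical convergence: for all initial points $t_1,t_2\in\mathbb{R}$, the generated sequence satisfies $\lim_{k\to\infty}t_k=t^*$.
   Context: $f^{(1)}$ denotes the first derivative of $f$. The switching fractional order gradient method generates, from initial points $t_1,t_2$, the sequence $$t_{k+2}=t_{k+1}-\rho f^{(1)}(t_{k+1})\left(|t_{k+1}-t_k|+\delta\right)^{1-\alpha},\qquad k\ge1,$$ where the pair $(\alpha,\delta)$ used to compute $t_{k+2}$ is chosen as follows. If there is an index $j$ with $2\le j\le k+1$ such that $|t_j-t_{j-1}|<1$ or $f^{(1)}(t_2)f^{(1)}(t_j)<0$ (so that a switch has occurred, which is permanent), then $(\alpha,\delta)=(\alpha_2,\delta_2)$. Otherwise $(\alpha,\delta)=(\alpha_1,0)$. *)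

theory Defs
  imports "HOL-Analysis.Analysis"
begin

definition has_switched :: "(real \<Rightarrow> real) \<Rightarrow> (nat \<Rightarrow> real) \<Rightarrow> nat \<Rightarrow> bool" where
  "has_switched f t n \<longleftrightarrow>
     (\<exists>j\<in>{2..n}. \<bar>t j - t (j - 1)\<bar> < 1 \<or> deriv f (t 2) * deriv f (t j) < 0)"

text \<open>Sequences are indexed from 1; the value \<open>t 0\<close> is never referred to.\<close>

definition switching_fractional_gradient_seq ::
  "(real \<Rightarrow> real) \<Rightarrow> real \<Rightarrow> real \<Rightarrow> real \<Rightarrow> real \<Rightarrow> real \<Rightarrow> real \<Rightarrow> (nat \<Rightarrow> real) \<Rightarrow> bool" where
  "switching_fractional_gradient_seq f \<rho> \<alpha>\<^sub>1 \<alpha>\<^sub>2 \<delta>\<^sub>2 t\<^sub>1 t\<^sub>2 t \<longleftrightarrow>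
     t 1 = t\<^sub>1 \<and> t 2 = t\<^sub>2 \<and>
     (\<forall>k\<ge>1. t (k + 2) =
        (let (\<alpha>, \<delta>) = (if has_switched f t (k + 1) then (\<alpha>\<^sub>2, \<delta>\<^sub>2) else (\<alpha>\<^sub>1, 0))
         in t (k + 1) - \<rho> * deriv f (t (k + 1)) * (\<bar>t (k + 1) - t k\<bar> + \<delta>) powr (1 - \<alpha>)))"

text \<open>The recursion is not vacuous: every pair of initial points generates a sequence,
  and it is unique from index 1 on.\<close>

lemma has_switched_cong:
  assumes "\<And>j. 1 \<le> j \<Longrightarrow> j \<le> n \<Longrightarrow> s j = t j"
  shows "has_switched f s n \<longleftrightarrow> has_switched f t n"
proof -
  have "s j = t j \<and> s (j - 1) = t (j - 1) \<and> s 2 = t 2" if "j \<in> {2..n}" for j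
    using that by (auto intro!: assms)
  then show ?thesis
    unfolding has_switched_def by (intro bex_cong) auto
qed

lemma switching_fractional_gradient_seq_exists:
  "\<exists>t. switching_fractional_gradient_seq f \<rho> \<alpha>\<^sub>1 \<alpha>\<^sub>2 \<delta>\<^sub>2 t\<^sub>1 t\<^sub>2 t"
proof -
  define F where "F = (\<lambda>(s :: nat \<Rightarrow> real) k.
     (let (\<alpha>, \<delta>) = (if has_switched f s (k + 1) then (\<alpha>\<^sub>2, \<delta>\<^sub>2) else (\<alpha>\<^sub>1, 0))
      in s (k + 1) - \<rho> * deriv f (s (k + 1)) * (\<bar>s (k + 1) - s k\<bar> + \<delta>) powr (1 - \<alpha>)))"
  define G where "G = (\<lambda>s n. if n \<le> 1 then t\<^sub>1 else if n = 2 then t\<^sub>2 else F s (n - 2))"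
  define t where "t = wfrec less_than G"
  have t_rec: "t n = G (cut t less_than n) n" for n
    unfolding t_def by (rule wfrec) simp
  have "t (k + 2) = F t k" if "k \<ge> 1" for k
  proof -
    have eq: "cut t less_than (k + 2) j = t j" if "j \<le> k + 1" for j
      using that by (simp add: cut_def)
    have sw: "has_switched f (cut t less_than (k + 2)) (k + 1) \<longleftrightarrow> has_switched f t (k + 1)"
      by (rule has_switched_cong) (rule eq)
    have "t (k + 2) = F (cut t less_than (k + 2)) k"
      using t_rec[of "k + 2"] that by (simp add: G_def)
    also have "\<dots> = F t k"
      unfolding F_def sw by (simp only: eq order.refl le_add1)
    finally show ?thesis .
  qed
  moreover have "t 1 = t\<^sub>1" "t 2 = t\<^sub>2"
    using t_rec[of 1] t_rec[of 2] by (simp_all add: G_def)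
  ultimately show ?thesis
    unfolding switching_fractional_gradient_seq_def F_def by blast
qed

lemma switching_fractional_gradient_seq_unique:
  assumes s: "switching_fractional_gradient_seq f \<rho> \<alpha>\<^sub>1 \<alpha>\<^sub>2 \<delta>\<^sub>2 t\<^sub>1 t\<^sub>2 s"
    and t: "switching_fractional_gradient_seq f \<rho> \<alpha>\<^sub>1 \<alpha>\<^sub>2 \<delta>\<^sub>2 t\<^sub>1 t\<^sub>2 t"
    and "n \<ge> 1"
  shows "s n = t n"
  using \<open>n \<ge> 1\<close>
proof (induction n rule: less_induct)
  case (less n)
  consider "n = 1" | "n = 2" | k where "k \<ge> 1" "n = k + 2"
    using less.prems by (metis add.commute le_add_diff_inverse less_one linorder_not_le
        nat_less_le not_less_eq_eq one_add_one plus_1_eq_Suc zero_less_diff)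
  then show ?case
  proof cases
    case 3
    have eq: "s j = t j" if "1 \<le> j" "j \<le> k + 1" for j
      using less.IH[of j] that 3 by simp
    have sw: "has_switched f s (k + 1) \<longleftrightarrow> has_switched f t (k + 1)"
      by (rule has_switched_cong) (rule eq)
    have "s (k + 1) = t (k + 1)" "s k = t k"
      using 3 by (auto intro: eq)
    then show ?thesis
      using s t 3 sw unfolding switching_fractional_gradient_seq_def by simp
  qed (use s t in \<open>simp_all add: switching_fractional_gradient_seq_def\<close>)
qed

end

theory Submission
  imports Defs
begin

text \<open>Once the method has switched, the bound on \<open>\<delta>\<^sub>2\<close> makes every effective step size at most
  \<open>1 / \<mu>\<close>, so an iterate moves towards \<open>tstar\<close> without overshooting. Hence the increments stay
  bounded, the step sizes are bounded away from zero, and the errors decrease to zero. The switch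
  always happens: otherwise every iterate stays on the same side of \<open>tstar\<close> while moving
  towards it by at least 1 per step.\<close>

text \<open>Adding the tangent inequalities at \<open>x\<close> and \<open>y\<close> cancels the
  values of \<open>f\<close> and leaves only the two slopes.\<close>

lemma convex_on_deriv_mono:
  fixes f :: "real \<Rightarrow> real"
  assumes "convex_on UNIV f" and "\<And>x. (f has_real_derivative g x) (at x)"
  shows "mono g"
proof (rule monoI)
  fix x y :: real assume "x \<le> y"
  have tangent: "f v - f u \<ge> g u * (v - u)" for u v
    using convex_on_imp_above_tangent[OF assms(1), of u v "g u"] assms(2) by simp
  have "g x * (y - x) \<le> g y * (y - x)"
    using tangent[of x y] tangent[of y x] by (simp add: algebra_simps)
  then show "g x \<le> g y"
    using \<open>x \<le> y\<close> by (cases "x = y") (auto simp: mult_le_cancel_right)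
qed

text \<open>Turns uniqueness of the minimizer into uniqueness of the zero of the derivative, the
  form in which the convergence arguments use it. A horizontal tangent supports a convex graph from
  below; the converse is Fermat's criterion.\<close>

lemma convex_on_deriv_eq_0_iff_minimizer:
  fixes f :: "real \<Rightarrow> real"
  assumes "convex_on UNIV f" and "(f has_real_derivative d) (at x)"
  shows "d = 0 \<longleftrightarrow> is_arg_min f (\<lambda>_. True) x"
proof
  assume "d = 0"
  then have "f y \<ge> f x" for y
    using convex_on_imp_above_tangent[OF assms(1), of x y d] assms(2) by simp
  then show "is_arg_min f (\<lambda>_. True) x"
    by (simp add: is_arg_min_linorder)
next
  assume "is_arg_min f (\<lambda>_. True) x"
  then have "\<And>y. f x \<le> f y"
    by (simp add: is_arg_min_linorder)
  then show "d = 0"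
    using DERIV_local_min[OF assms(2), of 1] by simp
qed

text \<open>By monotonicity the step points towards \<open>s\<close>, and its length is at most
  \<open>c * \<mu> * \<bar>x - s\<bar>\<close>, so it cannot pass \<open>s\<close>. Hence the error
  drops by exactly the length of the step.\<close>

lemma gradient_step_error:
  fixes g :: "real \<Rightarrow> real"
  assumes "mono g" and "g s = 0" and lip: "\<And>x. \<bar>g x\<bar> \<le> \<mu> * \<bar>x - s\<bar>"
    and "0 \<le> c" and "c * \<mu> \<le> 1"
  shows "\<bar>x - c * g x - s\<bar> = \<bar>x - s\<bar> - c * \<bar>g x\<bar>"
proof -
  have "c * \<bar>g x\<bar> \<le> c * (\<mu> * \<bar>x - s\<bar>)"
    using lip \<open>0 \<le> c\<close> by (rule mult_left_mono)
  also have "\<dots> = (c * \<mu>) * \<bar>x - s\<bar>" by simp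
  also have "\<dots> \<le> 1 * \<bar>x - s\<bar>"
    using \<open>c * \<mu> \<le> 1\<close> by (rule mult_right_mono) simp
  finally have le: "c * \<bar>g x\<bar> \<le> \<bar>x - s\<bar>" by simp
  show ?thesis
  proof (cases "x \<ge> s")
    case True
    then have "g x \<ge> 0" using \<open>mono g\<close> \<open>g s = 0\<close> by (metis monoD)
    then show ?thesis using le True by simp
  next
    case False
    then have "g x \<le> 0" using \<open>mono g\<close> \<open>g s = 0\<close> by (metis monoD linear)
    then have "\<bar>g x\<bar> = - g x" by simp
    with le False have "s - x + c * g x \<ge> 0" by simp
    with False \<open>\<bar>g x\<bar> = - g x\<close> show ?thesis by simp
  qed
qed

text \<open>The errors decrease to some limit \<open>l\<close>. If \<open>l\<close> were positive,
  the iterates would stay where the gradient is bounded away from zero, and every step would reduce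
  the error by a fixed amount.\<close>

lemma gradient_descent_variable_step_tendsto:
  fixes g :: "real \<Rightarrow> real" and u c :: "nat \<Rightarrow> real"
  assumes "mono g" and zero: "\<And>x. g x = 0 \<longleftrightarrow> x = s" and lip: "\<And>x. \<bar>g x\<bar> \<le> \<mu> * \<bar>x - s\<bar>"
    and "0 < c\<^sub>0" and c: "\<And>n. c\<^sub>0 \<le> c n" "\<And>n. c n * \<mu> \<le> 1"
    and u: "\<And>n. u (Suc n) = u n - c n * g (u n)"
  shows "u \<longlonglongrightarrow> s"
proof -
  define e where "e = (\<lambda>n. \<bar>u n - s\<bar>)"
  have c_nonneg: "0 \<le> c n" for n
    using c(1)[of n] \<open>0 < c\<^sub>0\<close> by simp
  have "g s = 0"
    using zero by simp
  then have e_Suc: "e (Suc n) = e n - c n * \<bar>g (u n)\<bar>" for n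
    unfolding e_def u
    by (rule gradient_step_error[OF \<open>mono g\<close> _ lip c_nonneg c(2)])
  have "decseq e"
    using e_Suc c_nonneg by (intro decseq_SucI) simp
  moreover have "0 \<le> e n" for n
    by (simp add: e_def)
  ultimately obtain l where l: "e \<longlonglongrightarrow> l" "\<And>n. l \<le> e n"
    using decseq_convergent[of e 0] by blast
  have "0 \<le> l"
    using LIMSEQ_le_const[OF l(1)] \<open>\<And>n. 0 \<le> e n\<close> by blast
  have "l = 0"
  proof (rule ccontr)
    assume "l \<noteq> 0"
    with \<open>0 \<le> l\<close> have "0 < l" by simp
    \<comment> \<open>By monotonicity \<open>m\<close> bounds the size of \<open>g\<close> from
      below at distance at least \<open>l\<close> from \<open>s\<close>, where all iterates
      lie.\<close>
    define m where "m = min (g (s + l)) (- g (s - l))"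
    have "0 \<le> g (s + l)" "g (s - l) \<le> 0"
      using \<open>mono g\<close>[THEN monoD, of s "s + l"] \<open>mono g\<close>[THEN monoD, of "s - l" s]
        \<open>0 \<le> l\<close> \<open>g s = 0\<close> by auto
    moreover have "g (s + l) \<noteq> 0" "g (s - l) \<noteq> 0"
      using zero \<open>0 < l\<close> by auto
    ultimately have "0 < m" by (simp add: m_def)
    have "m \<le> \<bar>g (u n)\<bar>" for n
    proof -
      have "u n \<ge> s + l \<or> u n \<le> s - l"
        using l(2)[of n] by (auto simp: e_def abs_if split: if_splits)
      then show ?thesis
        using \<open>mono g\<close>[THEN monoD, of "s + l" "u n"] \<open>mono g\<close>[THEN monoD, of "u n" "s - l"]
        by (auto simp: m_def)
    qed
    then have "c\<^sub>0 * m \<le> e n - e (Suc n)" for n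
      unfolding e_Suc using mult_mono[OF c(1)[of n], of m "\<bar>g (u n)\<bar>"] \<open>0 < m\<close> c_nonneg by simp
    moreover have "(\<lambda>n. e n - e (Suc n)) \<longlonglongrightarrow> l - l"
      by (intro tendsto_diff l(1) LIMSEQ_Suc)
    ultimately have "c\<^sub>0 * m \<le> 0"
      using LIMSEQ_le_const[of "\<lambda>n. e n - e (Suc n)" 0 "c\<^sub>0 * m"] by simp
    with \<open>0 < c\<^sub>0\<close> \<open>0 < m\<close> show False
      by (simp add: mult_le_0_iff)
  qed
  then show ?thesis
    using l(1) by (simp add: e_def tendsto_rabs_zero_iff LIM_zero_iff)
qed

text \<open>The factor multiplying the gradient is treated as a variable step size. It remains to
  trap it between a positive constant and \<open>1 / \<mu>\<close>.\<close>

lemma regularized_fractional_gradient_tendsto: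
  fixes g :: "real \<Rightarrow> real" and u :: "nat \<Rightarrow> real"
  assumes "mono g" and zero: "\<And>x. g x = 0 \<longleftrightarrow> x = s" and lip: "\<And>x. \<bar>g x\<bar> \<le> \<mu> * \<bar>x - s\<bar>"
    and "0 < \<mu>" and "0 < \<rho>" and "1 < \<alpha>" and \<delta>: "(\<rho> * \<mu>) powr (1 / (\<alpha> - 1)) \<le> \<delta>"
    and u: "\<And>n. u (Suc (Suc n)) =
      u (Suc n) - \<rho> * g (u (Suc n)) * (\<bar>u (Suc n) - u n\<bar> + \<delta>) powr (1 - \<alpha>)"
  shows "u \<longlonglongrightarrow> s"
proof -
  define c where "c = (\<lambda>n. \<rho> * (\<bar>u (Suc n) - u n\<bar> + \<delta>) powr (1 - \<alpha>))"
  \<comment> \<open>bounds the increments: the first one, and by the absence of overshooting every later one\<close>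
  define \<Delta> where "\<Delta> = max \<bar>u 1 - u 0\<bar> \<bar>u 1 - s\<bar>"
  have step: "u (Suc (Suc n)) = u (Suc n) - c n * g (u (Suc n))" for n
    unfolding u c_def by simp
  have "0 < (\<rho> * \<mu>) powr (1 / (\<alpha> - 1))"
    using \<open>0 < \<mu>\<close> \<open>0 < \<rho>\<close> by simp
  with \<delta> have "0 < \<delta>" by linarith
  have c_nonneg: "0 \<le> c n" for n
    using \<open>0 < \<rho>\<close> by (simp add: c_def)
  have c_le: "c n * \<mu> \<le> 1" for n
  proof -
    \<comment> \<open>The exponent is negative, so the power is largest at the smallest base. The
      lower bound on \<delta> is the base at which the step size equals
      \<open>1 / \<mu>\<close>.\<close>
    have "(\<bar>u (Suc n) - u n\<bar> + \<delta>) powr (1 - \<alpha>) \<le> ((\<rho> * \<mu>) powr (1 / (\<alpha> - 1))) powr (1 - \<alpha>)"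
      using \<open>1 < \<alpha>\<close> \<delta> \<open>0 < (\<rho> * \<mu>) powr _\<close> by (intro powr_mono2') auto
    also have "\<dots> = (\<rho> * \<mu>) powr (1 / (\<alpha> - 1) * (1 - \<alpha>))"
      by (rule powr_powr)
    also have "1 / (\<alpha> - 1) * (1 - \<alpha>) = - 1"
      using \<open>1 < \<alpha>\<close> by (simp add: divide_simps)
    also have "(\<rho> * \<mu>) powr (- 1) = 1 / (\<rho> * \<mu>)"
      using \<open>0 < \<mu>\<close> \<open>0 < \<rho>\<close> by (simp add: powr_minus_divide)
    finally show ?thesis
      using \<open>0 < \<mu>\<close> \<open>0 < \<rho>\<close> by (simp add: c_def field_simps)
  qed
  have "g s = 0"
    using zero by simp
  then have err: "\<bar>u (Suc (Suc n)) - s\<bar> = \<bar>u (Suc n) - s\<bar> - c n * \<bar>g (u (Suc n))\<bar>" for n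
    unfolding step by (rule gradient_step_error[OF \<open>mono g\<close> _ lip c_nonneg c_le])
  have err_le: "\<bar>u (Suc n) - s\<bar> \<le> \<Delta>" for n
  proof (induction n)
    case (Suc n)
    have "0 \<le> c n * \<bar>g (u (Suc n))\<bar>" by (simp add: c_nonneg)
    with Suc err[of n] show ?case by linarith
  qed (simp add: \<Delta>_def)
  have diff_le: "\<bar>u (Suc n) - u n\<bar> \<le> \<Delta>" for n
  proof (cases n)
    case (Suc k)
    have "\<bar>u (Suc (Suc k)) - u (Suc k)\<bar> = c k * \<bar>g (u (Suc k))\<bar>"
      unfolding step by (simp add: abs_mult c_nonneg)
    \<comment> \<open>By \<open>err\<close> the length of the step is the drop in error, hence at
      most the error before the step.\<close>
    also have "\<dots> \<le> \<Delta>"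
      using err[of k] err_le[of k] by linarith
    finally show ?thesis by (simp add: Suc)
  qed (simp add: \<Delta>_def)
  \<comment> \<open>Again because the exponent is negative, bounded increments keep the step sizes
    away from zero.\<close>
  have "\<rho> * (\<Delta> + \<delta>) powr (1 - \<alpha>) \<le> c n" for n
    unfolding c_def using \<open>0 < \<rho>\<close> \<open>0 < \<delta>\<close> \<open>1 < \<alpha>\<close> diff_le[of n]
    by (intro mult_left_mono powr_mono2') auto
  moreover have "0 < \<rho> * (\<Delta> + \<delta>) powr (1 - \<alpha>)"
    using \<open>0 < \<rho>\<close> \<open>0 < \<delta>\<close> diff_le[of 0] by simp
  ultimately have "(\<lambda>n. u (Suc n)) \<longlonglongrightarrow> s"
    using gradient_descent_variable_step_tendsto[OF \<open>mono g\<close> zero lip, of _ c "\<lambda>n. u (Suc n)"]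
      c_le step by blast
  then show ?thesis
    by (rule LIMSEQ_imp_Suc)
qed

lemma unit_decreasing_imp_neg:
  fixes h :: "nat \<Rightarrow> real"
  assumes "\<And>n. h (Suc n) \<le> h n - 1"
  shows "\<exists>n. h n < 0"
proof -
  have "h n \<le> h 0 - real n" for n
  proof (induction n)
    case (Suc n)
    then show ?case using assms[of n] by simp
  qed simp
  moreover obtain n where "h 0 < real n"
    using reals_Archimedean2 by blast
  ultimately show ?thesis
    by (metis diff_less_0_iff_less order_le_less_trans)
qed

text \<open>Without a switch all gradients share one weak sign, so the signed distance to
  \<open>s\<close> falls by the length of each step, at least 1, and becomes negative. Beyond
  \<open>s\<close>, however, the gradient has the opposite sign.\<close>

lemma eventually_has_switched:
  assumes "mono (deriv f)" and zero: "\<And>x. deriv f x = 0 \<longleftrightarrow> x = s" and "0 < \<rho>"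
    and t: "switching_fractional_gradient_seq f \<rho> \<alpha>\<^sub>1 \<alpha>\<^sub>2 \<delta>\<^sub>2 t\<^sub>1 t\<^sub>2 t"
  shows "\<exists>N. has_switched f t N"
proof (rule ccontr)
  assume never: "\<nexists>N. has_switched f t N"
  \<comment> \<open>The shift makes \<open>u 0\<close> the reference point \<open>t 2\<close> of the
    sign test; the factor \<open>d\<close> below treats both sides of \<open>s\<close> at
    once.\<close>
  define u where "u = (\<lambda>n. t (n + 2))"
  define d where "d = sgn (deriv f (u 0))"
  define b where "b = (\<lambda>n. \<rho> * \<bar>t (n + 2) - t (n + 1)\<bar> powr (1 - \<alpha>\<^sub>1))"
  have long: "1 \<le> \<bar>t (n + 2) - t (n + 1)\<bar>"
    and same_sign: "0 \<le> deriv f (u 0) * deriv f (u n)" for n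
    using never unfolding has_switched_def u_def
    by (auto simp: not_less numeral_2_eq_2 dest!: spec[of _ "n + 2"] bspec[of _ _ "n + 2"])
  have step: "u (Suc n) = u n - b n * deriv f (u n)" for n
    using t never unfolding switching_fractional_gradient_seq_def u_def b_def
    by (auto dest!: spec[of _ "n + 1"] simp: numeral_eq_Suc)
  have len: "1 \<le> \<bar>u (Suc n) - u n\<bar>" for n
    using long[of "Suc n"] by (simp add: u_def)
  have b_nonneg: "0 \<le> b n" for n
    using \<open>0 < \<rho>\<close> by (simp add: b_def)
  \<comment> \<open>A zero gradient would give an increment of length 0, which triggers the
    switch.\<close>
  have "deriv f (u 0) \<noteq> 0"
    using len[of 0] step[of 0] by auto
  then consider (pos) "d = 1" "0 < deriv f (u 0)" | (neg) "d = - 1" "deriv f (u 0) < 0"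
    unfolding d_def by (metis linorder_neqE_linordered_idom sgn_neg sgn_pos)
  note d_cases = this
  have d_deriv: "d * deriv f (u n) = \<bar>deriv f (u n)\<bar>" for n
    using same_sign[of n] by (cases rule: d_cases) (auto simp: zero_le_mult_iff)
  have "d * (u (Suc n) - s) \<le> d * (u n - s) - 1" for n
  proof -
    have "d * (u (Suc n) - u n) = - (b n * (d * deriv f (u n)))"
      unfolding step by (simp add: algebra_simps)
    also have "\<dots> = - \<bar>u (Suc n) - u n\<bar>"
      unfolding step d_deriv by (simp add: abs_mult b_nonneg)
    finally show ?thesis
      using len[of n] by (simp add: algebra_simps)
  qed
  then obtain n where n: "d * (u n - s) < 0"
    using unit_decreasing_imp_neg[of "\<lambda>n. d * (u n - s)"] by blast
  have "deriv f s = 0" "deriv f (u n) \<noteq> 0"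
    using zero n by auto
  then have "d * deriv f (u n) < 0"
    using n \<open>mono (deriv f)\<close>[THEN monoD, of s "u n"] \<open>mono (deriv f)\<close>[THEN monoD, of "u n" s]
    by (cases rule: d_cases) auto
  then show False
    using d_deriv[of n] by simp
qed

theorem theorem5:
  fixes f :: "real \<Rightarrow> real" and tstar \<mu> \<rho> \<alpha>\<^sub>1 \<alpha>\<^sub>2 \<delta>\<^sub>2 :: real
  assumes smooth: "f C1_differentiable_on UNIV"
    and convex: "convex_on UNIV f"
    and unique_minimizer: "\<And>x. is_arg_min f (\<lambda>_. True) x \<longleftrightarrow> x = tstar"
    and "\<mu> > 0"
    and lipschitz_gradient: "\<And>x y. \<bar>deriv f x - deriv f y\<bar> \<le> \<mu> * \<bar>x - y\<bar>"
    and "\<rho> > 0"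
    and "0 < \<alpha>\<^sub>1" and "\<alpha>\<^sub>1 < 1" and "1 < \<alpha>\<^sub>2" and "\<alpha>\<^sub>2 < 2"
    and "\<delta>\<^sub>2 \<ge> (\<rho> * \<mu>) powr (1 / (\<alpha>\<^sub>2 - 1))"
  shows "\<forall>t\<^sub>1 t\<^sub>2 t. switching_fractional_gradient_seq f \<rho> \<alpha>\<^sub>1 \<alpha>\<^sub>2 \<delta>\<^sub>2 t\<^sub>1 t\<^sub>2 t \<longrightarrow>
           t \<longlonglongrightarrow> tstar"
proof (intro allI impI)
  fix t\<^sub>1 t\<^sub>2 t assume t: "switching_fractional_gradient_seq f \<rho> \<alpha>\<^sub>1 \<alpha>\<^sub>2 \<delta>\<^sub>2 t\<^sub>1 t\<^sub>2 t"
  have deriv: "(f has_real_derivative deriv f x) (at x)" for x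
    using smooth unfolding C1_differentiable_on_eq
    by (auto simp: real_differentiable_def intro: DERIV_deriv_iff_real_differentiable[THEN iffD2])
  have mono: "mono (deriv f)"
    using convex deriv by (rule convex_on_deriv_mono)
  have zero: "deriv f x = 0 \<longleftrightarrow> x = tstar" for x
    using convex_on_deriv_eq_0_iff_minimizer[OF convex deriv] unique_minimizer by simp
  have lip: "\<bar>deriv f x\<bar> \<le> \<mu> * \<bar>x - tstar\<bar>" for x
    using lipschitz_gradient[of x tstar] zero[of tstar] by simp
  obtain N where N: "has_switched f t N"
    using eventually_has_switched[OF mono zero \<open>\<rho> > 0\<close> t] by blast
  \<comment> \<open>The switch is permanent: a witness \<open>j\<close> stays in the growing range
    of indices.\<close>
  have switched: "has_switched f t n" if "N \<le> n" for n
    using N that unfolding has_switched_def by force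
  \<comment> \<open>The offset \<open>N + 1\<close> makes every index \<open>k = n + N + 1\<close>
    at least 1, as the recursion demands, even for \<open>N = 0\<close>; the switch is then tested
    at \<open>k + 1\<close>, beyond \<open>N\<close>.\<close>
  have "t (Suc (Suc n) + N + 1) = t (Suc n + N + 1) - \<rho> * deriv f (t (Suc n + N + 1)) *
      (\<bar>t (Suc n + N + 1) - t (n + N + 1)\<bar> + \<delta>\<^sub>2) powr (1 - \<alpha>\<^sub>2)" for n
  proof -
    have "t ((n + N + 1) + 2) = t ((n + N + 1) + 1) - \<rho> * deriv f (t ((n + N + 1) + 1)) *
      (\<bar>t ((n + N + 1) + 1) - t (n + N + 1)\<bar> + \<delta>\<^sub>2) powr (1 - \<alpha>\<^sub>2)"
      using t switched[of "(n + N + 1) + 1"]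
      unfolding switching_fractional_gradient_seq_def by simp
    then show ?thesis by (simp add: numeral_eq_Suc)
  qed
  then have "(\<lambda>n. t (n + N + 1)) \<longlonglongrightarrow> tstar"
    by (rule regularized_fractional_gradient_tendsto
        [OF mono zero lip \<open>\<mu> > 0\<close> \<open>\<rho> > 0\<close> \<open>1 < \<alpha>\<^sub>2\<close> \<open>\<delta>\<^sub>2 \<ge> _\<close>])
  then show "t \<longlonglongrightarrow> tstar"
    using LIMSEQ_offset[of t "N + 1"] by (simp add: add.assoc)
qed

end
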